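(* The satisfiability problem for HyperQPTL formulas in the $\forall\exists$ fragment is undecidable: there is no algorithm that, given a HyperQPTL formula whose trace quantifier prefix is a universal trace quantifier followed by an existential one, decides whether some set of traces $T$ satisfies it.
   Context: Traces are $t\in(2^{AP})^\omega$, $t[i]$ the $i$-th element. HyperQPTL syntax: $\varphi ::= \forall\pi.\varphi \mid \exists\pi.\varphi \mid \exists q.\varphi \mid \forall q.\varphi \mid \psi$, $\psi ::= a_\pi \mid q \mid \neg\psi \mid \psi\vee\psi \mid \mathsf{X}\psi \mid \psi\,\mathsf{U}\,\psi$ (prenex quantifiers; $\pi$ trace variables, $q$ propositional variables). Semantics over a trace set $T$, assignment $\Pi$ (trace variables to traces of $T$, each propositional variable $q$ to a trace in $(2^{\{q\}})^\omega$), position $i$: $a_\pi$ holds iff $a\in\Pi(\pi)[i]$; $q$ holds iff $q\in\Pi(q)[i]$; $\mathsf X$, $\mathsf U$, Boolean connectives as in LTL; $\exists\pi$ ranges over $T$, $\exists q$ over $(2^{\{q\}})^\omega$; universal quantifiers dual; $T\models\varphi$ iff $\emptyset,0\models_T\varphi$. Fragments are defined by the trace quantifier prefix only.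
   Formalization: The set of traces T is required to be nonempty; the empty set would vacuously satisfy every formula whose first trace quantifier is universal, so the problem would be trivially decidable. *)

theory Defs
  imports "HOL-Library.Nat_Bijection" "HOL-Library.Omega_Words_Fun"
begin

section \<open>HyperQPTL\<close>

text \<open>
  Atomic propositions, trace variables and propositional variables are drawn from three separate
  countably infinite supplies of names, so that formulas are finite objects that can be handed
  to an algorithm.
\<close>

type_synonym ap = nat
type_synonym tvar = nat
type_synonym pvar = nat

type_synonym trace = "ap set word"

datatype body =
    Ap ap tvar
  | PVar pvar
  | Neg body
  | Disj body body
  | Next body
  | Until body body

datatype hyperqptl =
    AllTrace tvar hyperqptl
  | ExTrace tvar hyperqptl
  | ExProp pvar hyperqptl
  | AllProp pvar hyperqptl
  | Body body

text \<open>
  The assignment is split into a part \<open>\<Pi>\<close> for trace variables and a part \<open>\<Theta>\<close> for propositional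
  variables. The value of an atom under an unassigned variable is irrelevant for closed formulas.
\<close>

primrec sat_body ::
  "(tvar \<rightharpoonup> trace) \<Rightarrow> (pvar \<rightharpoonup> pvar set word) \<Rightarrow> nat \<Rightarrow> body \<Rightarrow> bool" where
  "sat_body \<Pi> \<Theta> i (Ap a \<pi>) \<longleftrightarrow> (\<exists>t. \<Pi> \<pi> = Some t \<and> a \<in> t i)"
| "sat_body \<Pi> \<Theta> i (PVar q) \<longleftrightarrow> (\<exists>t. \<Theta> q = Some t \<and> q \<in> t i)"
| "sat_body \<Pi> \<Theta> i (Neg \<psi>) \<longleftrightarrow> \<not> sat_body \<Pi> \<Theta> i \<psi>"
| "sat_body \<Pi> \<Theta> i (Disj \<psi> \<chi>) \<longleftrightarrow> sat_body \<Pi> \<Theta> i \<psi> \<or> sat_body \<Pi> \<Theta> i \<chi>"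
| "sat_body \<Pi> \<Theta> i (Next \<psi>) \<longleftrightarrow> sat_body \<Pi> \<Theta> (Suc i) \<psi>"
| "sat_body \<Pi> \<Theta> i (Until \<psi> \<chi>) \<longleftrightarrow>
     (\<exists>j\<ge>i. sat_body \<Pi> \<Theta> j \<chi> \<and> (\<forall>k. i \<le> k \<and> k < j \<longrightarrow> sat_body \<Pi> \<Theta> k \<psi>))"

definition prop_traces :: "pvar \<Rightarrow> pvar set word set" where
  "prop_traces q = {t. \<forall>i. t i \<subseteq> {q}}"

primrec sat ::
  "trace set \<Rightarrow> (tvar \<rightharpoonup> trace) \<Rightarrow> (pvar \<rightharpoonup> pvar set word) \<Rightarrow> nat \<Rightarrow> hyperqptl \<Rightarrow> bool" where
  "sat T \<Pi> \<Theta> i (AllTrace \<pi> \<phi>) \<longleftrightarrow> (\<forall>t\<in>T. sat T (\<Pi>(\<pi> \<mapsto> t)) \<Theta> i \<phi>)"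
| "sat T \<Pi> \<Theta> i (ExTrace \<pi> \<phi>) \<longleftrightarrow> (\<exists>t\<in>T. sat T (\<Pi>(\<pi> \<mapsto> t)) \<Theta> i \<phi>)"
| "sat T \<Pi> \<Theta> i (ExProp q \<phi>) \<longleftrightarrow> (\<exists>t\<in>prop_traces q. sat T \<Pi> (\<Theta>(q \<mapsto> t)) i \<phi>)"
| "sat T \<Pi> \<Theta> i (AllProp q \<phi>) \<longleftrightarrow> (\<forall>t\<in>prop_traces q. sat T \<Pi> (\<Theta>(q \<mapsto> t)) i \<phi>)"
| "sat T \<Pi> \<Theta> i (Body \<psi>) \<longleftrightarrow> sat_body \<Pi> \<Theta> i \<psi>"

definition models :: "trace set \<Rightarrow> hyperqptl \<Rightarrow> bool" where
  "models T \<phi> \<longleftrightarrow> sat T Map.empty Map.empty 0 \<phi>"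

text \<open>
  As usual for hyperlogics, a model is a nonempty set of traces. The empty set would vacuously
  satisfy every closed formula whose first trace quantifier is universal.
\<close>

definition satisfiable :: "hyperqptl \<Rightarrow> bool" where
  "satisfiable \<phi> \<longleftrightarrow> (\<exists>T. T \<noteq> {} \<and> models T \<phi>)"

primrec body_tvars :: "body \<Rightarrow> tvar set" where
  "body_tvars (Ap a \<pi>) = {\<pi>}"
| "body_tvars (PVar q) = {}"
| "body_tvars (Neg \<psi>) = body_tvars \<psi>"
| "body_tvars (Disj \<psi> \<chi>) = body_tvars \<psi> \<union> body_tvars \<chi>"
| "body_tvars (Next \<psi>) = body_tvars \<psi>"
| "body_tvars (Until \<psi> \<chi>) = body_tvars \<psi> \<union> body_tvars \<chi>"

primrec body_pvars :: "body \<Rightarrow> pvar set" where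
  "body_pvars (Ap a \<pi>) = {}"
| "body_pvars (PVar q) = {q}"
| "body_pvars (Neg \<psi>) = body_pvars \<psi>"
| "body_pvars (Disj \<psi> \<chi>) = body_pvars \<psi> \<union> body_pvars \<chi>"
| "body_pvars (Next \<psi>) = body_pvars \<psi>"
| "body_pvars (Until \<psi> \<chi>) = body_pvars \<psi> \<union> body_pvars \<chi>"

primrec free_tvars :: "hyperqptl \<Rightarrow> tvar set" where
  "free_tvars (AllTrace \<pi> \<phi>) = free_tvars \<phi> - {\<pi>}"
| "free_tvars (ExTrace \<pi> \<phi>) = free_tvars \<phi> - {\<pi>}"
| "free_tvars (ExProp q \<phi>) = free_tvars \<phi>"
| "free_tvars (AllProp q \<phi>) = free_tvars \<phi>"
| "free_tvars (Body \<psi>) = body_tvars \<psi>"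

primrec free_pvars :: "hyperqptl \<Rightarrow> pvar set" where
  "free_pvars (AllTrace \<pi> \<phi>) = free_pvars \<phi>"
| "free_pvars (ExTrace \<pi> \<phi>) = free_pvars \<phi>"
| "free_pvars (ExProp q \<phi>) = free_pvars \<phi> - {q}"
| "free_pvars (AllProp q \<phi>) = free_pvars \<phi> - {q}"
| "free_pvars (Body \<psi>) = body_pvars \<psi>"

definition closed_formula :: "hyperqptl \<Rightarrow> bool" where
  "closed_formula \<phi> \<longleftrightarrow> free_tvars \<phi> = {} \<and> free_pvars \<phi> = {}"

datatype quantifier = Univ | Exis

text \<open>Propositional quantifiers are skipped: fragments restrict the trace quantifiers only.\<close>

primrec trace_prefix :: "hyperqptl \<Rightarrow> quantifier list" where
  "trace_prefix (AllTrace \<pi> \<phi>) = Univ # trace_prefix \<phi>"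
| "trace_prefix (ExTrace \<pi> \<phi>) = Exis # trace_prefix \<phi>"
| "trace_prefix (ExProp q \<phi>) = trace_prefix \<phi>"
| "trace_prefix (AllProp q \<phi>) = trace_prefix \<phi>"
| "trace_prefix (Body \<psi>) = []"

definition forall_exists_fragment :: "hyperqptl set" where
  "forall_exists_fragment = {\<phi>. closed_formula \<phi> \<and> trace_prefix \<phi> = [Univ, Exis]}"


section \<open>Algorithms\<close>

text \<open>
  Algorithms are Kleene's partial recursive functions. The proposition \<open>computes f xs y\<close> says that
  \<open>f\<close> terminates on the arguments \<open>xs\<close> with result \<open>y\<close>; there is no such \<open>y\<close> if \<open>f\<close> diverges or is
  applied to an unsuitable number of arguments.
\<close>

datatype recf =
    Zero
  | Succ
  | Proj nat
  | Comp recf "recf list"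
  | PrimRec recf recf
  | Mu recf

inductive computes :: "recf \<Rightarrow> nat list \<Rightarrow> nat \<Rightarrow> bool" where
  zero: "computes Zero xs 0"
| succ: "computes Succ [x] (Suc x)"
| proj: "i < length xs \<Longrightarrow> computes (Proj i) xs (xs ! i)"
| comp: "list_all2 (\<lambda>g y. computes g xs y) gs ys \<Longrightarrow> computes f ys z \<Longrightarrow>
    computes (Comp f gs) xs z"
| primrec_0: "computes f xs y \<Longrightarrow> computes (PrimRec f g) (0 # xs) y"
| primrec_Suc: "computes (PrimRec f g) (n # xs) y \<Longrightarrow> computes g (n # y # xs) z \<Longrightarrow>
    computes (PrimRec f g) (Suc n # xs) z"
| mu: "computes f (n # xs) 0 \<Longrightarrow> (\<forall>m<n. \<exists>y>0. computes f (m # xs) y) \<Longrightarrow>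
    computes (Mu f) xs n"

lemma computes_deterministic: "computes f xs y \<Longrightarrow> computes f xs z \<Longrightarrow> y = z"
proof (induction arbitrary: z rule: computes.induct)
  case (zero xs)
  then show ?case by (auto elim: computes.cases)
next
  case (succ x)
  then show ?case by (auto elim: computes.cases)
next
  case (proj i xs)
  from proj.prems show ?case by (cases rule: computes.cases) auto
next
  case (comp xs gs ys f z')
  from comp.prems obtain ys' where ys':
    "list_all2 (\<lambda>g y. computes g xs y) gs ys'" "computes f ys' z"
    by (cases rule: computes.cases) auto
  have "ys = ys'"
    using comp.IH(1) ys'(1) by (auto simp: list_all2_conv_all_nth intro!: nth_equalityI)
  with comp.IH(2) ys'(2) show ?case by simp
next
  case (primrec_0 f xs y g)
  from primrec_0.prems have "computes f xs z" by (cases rule: computes.cases) auto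
  with primrec_0.IH show ?case .
next
  case (primrec_Suc f g n xs y z')
  from primrec_Suc.prems obtain y' where
    "computes (PrimRec f g) (n # xs) y'" "computes g (n # y' # xs) z"
    by (cases rule: computes.cases) auto
  with primrec_Suc.IH show ?case by blast
next
  case (mu f n xs)
  from mu.prems have z: "computes f (z # xs) 0" "\<forall>m<z. \<exists>y>0. computes f (m # xs) y"
    by (cases rule: computes.cases; auto)+
  show ?case
  proof (cases n z rule: linorder_cases)
    case less
    with z(2) mu.IH(1) show ?thesis by fastforce
  next
    case greater
    with z(1) mu.IH(2) show ?thesis by fastforce
  qed
qed

text \<open>
  A decision procedure for a property \<open>P\<close> on the instances \<open>I\<close>, encoded as numbers by \<open>enc\<close>, has to
  terminate with the right answer on every instance; its behaviour on numbers that do not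
  encode an instance is unconstrained.
\<close>

definition decidable_on :: "('i \<Rightarrow> nat) \<Rightarrow> 'i set \<Rightarrow> ('i \<Rightarrow> bool) \<Rightarrow> bool" where
  "decidable_on enc I P \<longleftrightarrow>
     (\<exists>f. \<forall>x\<in>I. computes f [enc x] (if P x then 1 else 0))"

primrec body_code :: "body \<Rightarrow> nat" where
  "body_code (Ap a \<pi>) = prod_encode (0, prod_encode (a, \<pi>))"
| "body_code (PVar q) = prod_encode (1, q)"
| "body_code (Neg \<psi>) = prod_encode (2, body_code \<psi>)"
| "body_code (Disj \<psi> \<chi>) = prod_encode (3, prod_encode (body_code \<psi>, body_code \<chi>))"
| "body_code (Next \<psi>) = prod_encode (4, body_code \<psi>)"
| "body_code (Until \<psi> \<chi>) = prod_encode (5, prod_encode (body_code \<psi>, body_code \<chi>))"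

primrec formula_code :: "hyperqptl \<Rightarrow> nat" where
  "formula_code (AllTrace \<pi> \<phi>) = prod_encode (0, prod_encode (\<pi>, formula_code \<phi>))"
| "formula_code (ExTrace \<pi> \<phi>) = prod_encode (1, prod_encode (\<pi>, formula_code \<phi>))"
| "formula_code (ExProp q \<phi>) = prod_encode (2, prod_encode (q, formula_code \<phi>))"
| "formula_code (AllProp q \<phi>) = prod_encode (3, prod_encode (q, formula_code \<phi>))"
| "formula_code (Body \<psi>) = prod_encode (4, body_code \<psi>)"

lemma body_code_inj: "body_code \<psi> = body_code \<chi> \<Longrightarrow> \<psi> = \<chi>"
proof (induction \<psi> arbitrary: \<chi>)
  case (Ap a \<pi>) then show ?case by (cases \<chi>) auto
next
  case (PVar q) then show ?case by (cases \<chi>) auto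
next
  case (Neg \<psi>) then show ?case by (cases \<chi>) auto
next
  case (Disj \<psi>1 \<psi>2) then show ?case by (cases \<chi>) auto
next
  case (Next \<psi>) then show ?case by (cases \<chi>) auto
next
  case (Until \<psi>1 \<psi>2) then show ?case by (cases \<chi>) auto
qed

lemma formula_code_inj: "formula_code \<phi> = formula_code \<phi>' \<Longrightarrow> \<phi> = \<phi>'"
proof (induction \<phi> arbitrary: \<phi>')
  case (AllTrace \<pi> \<phi>) then show ?case by (cases \<phi>') auto
next
  case (ExTrace \<pi> \<phi>) then show ?case by (cases \<phi>') auto
next
  case (ExProp q \<phi>) then show ?case by (cases \<phi>') auto
next
  case (AllProp q \<phi>) then show ?case by (cases \<phi>') auto
next
  case (Body \<psi>) then show ?case by (cases \<phi>') (auto dest: body_code_inj)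
qed

end

theory Submission
  imports Defs "HOL-Library.Countable"
begin

text \<open>
  Every \<open>H\<close> has a formula that speaks about sets of traces representing judgments
  \<open>computes g xs y\<close>, where \<open>g\<close> ranges over the subterms of \<open>H\<close>. Below \<open>\<forall>\<pi>\<close>, a universally
  quantified proposition selects one premise of the rule that derives the judgment \<open>\<pi>\<close>, and
  \<open>\<exists>\<pi>'\<close> provides that premise; a reserved selection asks for the root judgment
  \<open>computes H [e] 0\<close>. So the formula is satisfiable iff \<open>computes H [e] 0\<close>. No bookkeeping for
  termination is needed, because every recursive demand decreases \<open>g\<close> or the recursion argument
  of a primitive recursion.

  The number \<open>e\<close> enters the formula only as a stack of \<open>Next\<close> operators, and the quantifier prefix
  does not depend on \<open>H\<close>. Hence for a putative decision procedure \<open>D\<close> the diagonal argument can be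
  carried out directly, without a universal function: take for \<open>H\<close> the composition of \<open>D\<close> with
  the map from the code \<open>e\<close> of a body to the code of its formula with input \<open>e\<close>.
\<close>

section \<open>Derived temporal operators\<close>

text \<open>The tautology is built from \<open>PVar 0\<close>, the proposition that the prefix binds
  anyway, so derived operators introduce no further free variable.\<close>

abbreviation top_body :: body where
  "top_body \<equiv> Disj (PVar 0) (Neg (PVar 0))"

definition conj_body :: "body \<Rightarrow> body \<Rightarrow> body" where
  "conj_body \<psi> \<chi> = Neg (Disj (Neg \<psi>) (Neg \<chi>))"

definition imp_body :: "body \<Rightarrow> body \<Rightarrow> body" where
  "imp_body \<psi> \<chi> = Disj (Neg \<psi>) \<chi>"

definition all_body :: "body list \<Rightarrow> body" where
  "all_body \<psi>s = foldr conj_body \<psi>s top_body"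

definition ev_body :: "body \<Rightarrow> body" where
  "ev_body \<psi> = Until top_body \<psi>"

definition once_body :: "body \<Rightarrow> body" where
  "once_body u = Until (Neg u) (conj_body u (Neg (Next (ev_body u))))"

definition is_body :: "body \<Rightarrow> nat \<Rightarrow> body" where
  "is_body u n = conj_body (once_body u) ((Next ^^ n) u)"

definition pos_body :: "body \<Rightarrow> body" where
  "pos_body u = conj_body (once_body u) (Neg u)"

text \<open>With numbers as positions, this says that the value of \<open>v\<close> is the value of
  \<open>u\<close> plus the constant \<open>n\<close>. All transfer of values between registers goes
  through it; \<open>n = 0\<close> is equality.\<close>

definition plus_body :: "body \<Rightarrow> nat \<Rightarrow> body \<Rightarrow> body" where
  "plus_body u n v =
     conj_body (conj_body (once_body u) (once_body v)) (ev_body (conj_body u ((Next ^^ n) v)))"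

definition le_body :: "body \<Rightarrow> body \<Rightarrow> body" where
  "le_body u v =
     conj_body (conj_body (once_body u) (once_body v)) (ev_body (conj_body u (ev_body v)))"

text \<open>A number is represented by the position of the only occurrence of an atom.\<close>

definition marks :: "(nat \<Rightarrow> bool) \<Rightarrow> nat \<Rightarrow> bool" where
  "marks w n \<longleftrightarrow> (\<forall>i. w i \<longleftrightarrow> i = n)"

lemma sat_conj_body [simp]:
  "sat_body \<Pi> \<Theta> i (conj_body \<psi> \<chi>) \<longleftrightarrow> sat_body \<Pi> \<Theta> i \<psi> \<and> sat_body \<Pi> \<Theta> i \<chi>"
  by (simp add: conj_body_def)

lemma sat_imp_body [simp]:
  "sat_body \<Pi> \<Theta> i (imp_body \<psi> \<chi>) \<longleftrightarrow> (sat_body \<Pi> \<Theta> i \<psi> \<longrightarrow> sat_body \<Pi> \<Theta> i \<chi>)"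
  by (simp add: imp_body_def)

lemma sat_all_body [simp]:
  "sat_body \<Pi> \<Theta> i (all_body \<psi>s) \<longleftrightarrow> (\<forall>\<psi>\<in>set \<psi>s. sat_body \<Pi> \<Theta> i \<psi>)"
  by (induction \<psi>s) (auto simp: all_body_def)

lemma sat_ev_body [simp]:
  "sat_body \<Pi> \<Theta> i (ev_body \<psi>) \<longleftrightarrow> (\<exists>j\<ge>i. sat_body \<Pi> \<Theta> j \<psi>)"
  by (auto simp: ev_body_def)

lemma sat_Next_funpow [simp]:
  "sat_body \<Pi> \<Theta> i ((Next ^^ n) \<psi>) \<longleftrightarrow> sat_body \<Pi> \<Theta> (i + n) \<psi>"
  by (induction n arbitrary: i) auto

lemma sat_once_body [simp]:
  "sat_body \<Pi> \<Theta> 0 (once_body u) \<longleftrightarrow> (\<exists>n. marks (\<lambda>i. sat_body \<Pi> \<Theta> i u) n)"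
proof
  assume "sat_body \<Pi> \<Theta> 0 (once_body u)"
  then obtain n where n: "sat_body \<Pi> \<Theta> n u" "\<forall>j\<ge>Suc n. \<not> sat_body \<Pi> \<Theta> j u"
      "\<forall>k<n. \<not> sat_body \<Pi> \<Theta> k u"
    by (auto simp: once_body_def)
  have "sat_body \<Pi> \<Theta> i u \<longleftrightarrow> i = n" for i
    using n by (cases i n rule: linorder_cases) auto
  then show "\<exists>n. marks (\<lambda>i. sat_body \<Pi> \<Theta> i u) n"
    by (auto simp: marks_def)
next
  assume "\<exists>n. marks (\<lambda>i. sat_body \<Pi> \<Theta> i u) n"
  then show "sat_body \<Pi> \<Theta> 0 (once_body u)"
    by (auto simp: once_body_def marks_def)
qed

lemma sat_is_body [simp]:
  "sat_body \<Pi> \<Theta> 0 (is_body u n) \<longleftrightarrow> marks (\<lambda>i. sat_body \<Pi> \<Theta> i u) n"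
  by (auto simp: is_body_def marks_def)

lemma sat_pos_body [simp]:
  "sat_body \<Pi> \<Theta> 0 (pos_body u) \<longleftrightarrow> (\<exists>n. marks (\<lambda>i. sat_body \<Pi> \<Theta> i u) (Suc n))"
proof
  assume "sat_body \<Pi> \<Theta> 0 (pos_body u)"
  then obtain n where "marks (\<lambda>i. sat_body \<Pi> \<Theta> i u) n" "\<not> sat_body \<Pi> \<Theta> 0 u"
    by (auto simp: pos_body_def)
  then show "\<exists>n. marks (\<lambda>i. sat_body \<Pi> \<Theta> i u) (Suc n)"
    by (cases n) (auto simp: marks_def)
qed (auto simp: pos_body_def marks_def)

lemma sat_plus_body [simp]:
  "sat_body \<Pi> \<Theta> 0 (plus_body u n v) \<longleftrightarrow>
     (\<exists>m. marks (\<lambda>i. sat_body \<Pi> \<Theta> i u) m \<and> marks (\<lambda>i. sat_body \<Pi> \<Theta> i v) (m + n))"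
  by (auto simp: plus_body_def marks_def)

lemma sat_le_body [simp]:
  "sat_body \<Pi> \<Theta> 0 (le_body u v) \<longleftrightarrow>
     (\<exists>m n. marks (\<lambda>i. sat_body \<Pi> \<Theta> i u) m \<and> marks (\<lambda>i. sat_body \<Pi> \<Theta> i v) n \<and> m \<le> n)"
  by (auto simp: le_body_def marks_def) blast

section \<open>Evaluation judgments as traces\<close>

instance recf :: countable
  by countable_datatype

text \<open>An arbitrary injection suffices: it shapes only \<open>evaluation_body H\<close>, one
  fixed body whose code the algorithm receives as a plain number.\<close>

definition lab :: "recf \<Rightarrow> nat \<Rightarrow> nat" where
  "lab g k = to_nat (g, k)"

lemma lab_eq_iff [simp]: "lab g k = lab g' k' \<longleftrightarrow> g = g' \<and> k = k'"
  by (simp add: lab_def)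

text \<open>
  The trace of a judgment \<open>computes g xs y\<close> stores \<open>g\<close> together with the number of arguments,
  \<open>y\<close>, \<open>xs\<close>, and the intermediate results that the last rule of a derivation needs. In addition,
  every trace stores the input of the root judgment.
\<close>

abbreviation (input) label_reg :: ap where "label_reg \<equiv> 0"
abbreviation (input) result_reg :: ap where "result_reg \<equiv> Suc 0"
abbreviation (input) input_reg :: ap where "input_reg \<equiv> 2"
definition arg_reg :: "nat \<Rightarrow> ap" where "arg_reg j = 2 * j + 3"
definition aux_reg :: "nat \<Rightarrow> ap" where "aux_reg j = 2 * j + 4"

abbreviation (input) old :: "ap \<Rightarrow> body" where "old r \<equiv> Ap r 0"
abbreviation (input) new :: "ap \<Rightarrow> body" where "new r \<equiv> Ap r (Suc 0)"
abbreviation (input) demand :: body where "demand \<equiv> PVar 0"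

definition stores :: "nat set word \<Rightarrow> nat \<Rightarrow> nat \<Rightarrow> bool" where
  "stores t r n \<longleftrightarrow> marks (\<lambda>i. r \<in> t i) n"

lemma stores_alt: "stores t r n \<longleftrightarrow> (\<forall>i. r \<in> t i \<longleftrightarrow> i = n)"
  by (simp add: stores_def marks_def)

lemma marks_eq_stores [simp]: "marks (\<lambda>i. r \<in> t i) n \<longleftrightarrow> stores t r n"
  by (simp add: stores_def)

lemma stores_unique: "stores t r m \<Longrightarrow> stores t r n \<Longrightarrow> m = n"
  by (auto simp: stores_alt)

text \<open>The result is left out because a premise determines only the function and its arguments;
  each rule constrains the result of a premise separately.\<close>

definition judges :: "trace \<Rightarrow> recf \<Rightarrow> nat list \<Rightarrow> bool" where
  "judges t g xs \<longleftrightarrow> stores t label_reg (lab g (length xs)) \<and>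
     (\<forall>j<length xs. stores t (arg_reg j) (xs ! j))"

lemma stores_iff: "stores t r m \<Longrightarrow> stores t r n \<longleftrightarrow> n = m"
  by (auto dest: stores_unique)

lemma judges_arg: "judges t g xs \<Longrightarrow> j < length xs \<Longrightarrow> stores t (arg_reg j) n \<longleftrightarrow> n = xs ! j"
  by (auto simp: judges_def intro: stores_unique)

section \<open>Evaluation rules as constraints on pairs of traces\<close>

definition args :: "nat \<Rightarrow> (body \<times> nat) list" where
  "args k = map (\<lambda>j. (old (arg_reg j), 0)) [0..<k]"

definition auxs :: "nat \<Rightarrow> (body \<times> nat) list" where
  "auxs k = map (\<lambda>j. (old (aux_reg j), 0)) [0..<k]"

text \<open>
  The second components of the list are offsets to be added to the arguments of the premise:
  this is how a premise with argument \<open>n\<close> is derived from a conclusion with argument \<open>Suc n\<close>.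
\<close>

definition premise :: "recf \<Rightarrow> (body \<times> nat) list \<Rightarrow> body" where
  "premise g us = conj_body (is_body (new label_reg) (lab g (length us)))
     (all_body (map (\<lambda>j. plus_body (new (arg_reg j)) (snd (us ! j)) (fst (us ! j))) [0..<length us]))"

text \<open>
  The quantified proposition selects the premise for which the existentially quantified trace has
  to be a judgment. This allows for rules with several premises, and in the case of \<open>Mu\<close> for a
  number of premises that depends on the result. Position 0 is reserved for the root judgment.
\<close>

fun rule_body :: "recf \<Rightarrow> nat \<Rightarrow> body" where
  "rule_body Zero k = is_body (old result_reg) 0"
| "rule_body Succ k =
     (if k = 1 then plus_body (old (arg_reg 0)) 1 (old result_reg) else Neg top_body)"
| "rule_body (Proj i) k =
     (if i < k then plus_body (old (arg_reg i)) 0 (old result_reg) else Neg top_body)"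
| "rule_body (Comp f gs) k = all_body
     (imp_body (is_body demand (Suc (length gs)))
        (conj_body (premise f (auxs (length gs))) (plus_body (new result_reg) 0 (old result_reg))) #
      map (\<lambda>i. imp_body (is_body demand (Suc i))
        (conj_body (premise (gs ! i) (args k)) (plus_body (new result_reg) 0 (old (aux_reg i)))))
        [0..<length gs])"
| "rule_body (PrimRec f h) k =
     (if k = 0 then Neg top_body else all_body
       [imp_body (is_body (old (arg_reg 0)) 0)
          (conj_body (premise f (tl (args k))) (plus_body (new result_reg) 0 (old result_reg))),
        imp_body (conj_body (pos_body (old (arg_reg 0))) (is_body demand 1))
          (conj_body (premise (PrimRec f h) ((old (arg_reg 0), 1) # tl (args k)))
             (plus_body (new result_reg) 0 (old (aux_reg 0)))),
        imp_body (conj_body (pos_body (old (arg_reg 0))) (is_body demand 2))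
          (conj_body (premise h ((old (arg_reg 0), 1) # (old (aux_reg 0), 0) # tl (args k)))
             (plus_body (new result_reg) 0 (old result_reg)))])"
| "rule_body (Mu f) k = all_body
     [imp_body (le_body demand (old result_reg))
        (conj_body (premise f ((demand, 1) # args k)) (pos_body (new result_reg))),
      imp_body (plus_body (old result_reg) 1 demand)
        (conj_body (premise f ((demand, 1) # args k)) (is_body (new result_reg) 0))]"

text \<open>Functions are paired with the number of arguments they receive, on which their rule
  depends. For \<open>PrimRec\<close> with \<open>k = 0\<close> the value of \<open>k - 1\<close> is
  harmless, since the rule itself is then unsatisfiable.\<close>

fun subterms :: "recf \<Rightarrow> nat \<Rightarrow> (recf \<times> nat) list" where
  "subterms Zero k = [(Zero, k)]"
| "subterms Succ k = [(Succ, k)]"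
| "subterms (Proj i) k = [(Proj i, k)]"
| "subterms (Comp f gs) k =
     (Comp f gs, k) # subterms f (length gs) @ concat (map (\<lambda>g. subterms g k) gs)"
| "subterms (PrimRec f h) k = (PrimRec f h, k) # subterms f (k - 1) @ subterms h (Suc k)"
| "subterms (Mu f) k = (Mu f, k) # subterms f (Suc k)"

text \<open>The propositional quantifier also ranges over sequences that select nothing or several
  positions. Unless they contain position 0, the guard \<open>once_body demand\<close> makes them
  impose nothing.\<close>

definition evaluation_body :: "recf \<Rightarrow> body" where
  "evaluation_body H = conj_body
     (imp_body demand
       (conj_body (premise H [(old input_reg, 0)]) (is_body (new result_reg) 0)))
     (imp_body (conj_body (Neg demand) (once_body demand))
       (all_body (map (\<lambda>(g, k). imp_body (is_body (old label_reg) (lab g k)) (rule_body g k))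
          (subterms H 1))))"

text \<open>For \<open>G = Neg F\<close> the body says that \<open>input_reg\<close> holds at
  position \<open>e\<close> and that \<open>F\<close> holds. The disjunctive form keeps the code a
  plain nesting of pairs around the codes of the \<open>Next\<close> stack and of
  \<open>G\<close>.\<close>

definition diagonal_formula :: "nat \<Rightarrow> body \<Rightarrow> hyperqptl" where
  "diagonal_formula e G = AllTrace 0 (AllProp 0 (ExTrace (Suc 0) (Body
     (Neg (Disj ((Next ^^ e) (Neg (old input_reg))) G)))))"

abbreviation sat_pair :: "trace \<Rightarrow> trace \<Rightarrow> pvar set word \<Rightarrow> nat \<Rightarrow> body \<Rightarrow> bool" where
  "sat_pair t t' q \<equiv> sat_body [0 \<mapsto> t, Suc 0 \<mapsto> t'] [0 \<mapsto> q]"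

lemma models_diagonal_formula:
  "models T (diagonal_formula e (Neg F)) \<longleftrightarrow>
     (\<forall>t\<in>T. \<forall>q\<in>prop_traces 0. \<exists>t'\<in>T. input_reg \<in> t e \<and> sat_pair t t' q 0 F)"
  by (simp add: models_def diagonal_formula_def)

text \<open>Separates what the new trace judges from the way its arguments arise from the old trace
  and the demand.\<close>

lemma sat_premise:
  "sat_pair t t' q 0 (premise g us) \<longleftrightarrow>
     (\<exists>xs. judges t' g xs \<and>
       list_all2 (\<lambda>u x. marks (\<lambda>i. sat_pair t t' q i (fst u)) (x + snd u)) us xs)"
    (is "?L \<longleftrightarrow> ?R")
proof
  assume L: ?L
  have "\<forall>j<length us. \<exists>x. stores t' (arg_reg j) x \<and>
      marks (\<lambda>i. sat_pair t t' q i (fst (us ! j))) (x + snd (us ! j))"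
    using L by (auto simp: premise_def)
  then obtain x where x: "\<forall>j<length us. stores t' (arg_reg j) (x j) \<and>
      marks (\<lambda>i. sat_pair t t' q i (fst (us ! j))) (x j + snd (us ! j))"
    by metis
  have "judges t' g (map x [0..<length us])"
    using L x by (auto simp: judges_def premise_def)
  moreover have "list_all2 (\<lambda>u x. marks (\<lambda>i. sat_pair t t' q i (fst u)) (x + snd u)) us
      (map x [0..<length us])"
    using x by (simp add: list_all2_conv_all_nth)
  ultimately show ?R by blast
next
  assume ?R
  then show ?L
    unfolding premise_def judges_def list_all2_conv_all_nth by fastforce
qed

lemma judges_args:
  assumes "judges t g xs"
  shows "list_all2 (\<lambda>u x. marks (\<lambda>i. sat_pair t t' q i (fst u)) (x + snd u)) (args (length xs)) ys
    \<longleftrightarrow> ys = xs"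
  by (auto simp: judges_arg[OF assms] args_def list_all2_conv_all_nth intro!: nth_equalityI)

text \<open>Serves primitive recursion, whose premises inherit all arguments but the first. Putting
  the known first argument back in front reduces it to \<open>judges_args\<close>.\<close>

lemma judges_tl_args:
  assumes "judges t g (x # xs)"
  shows "list_all2 (\<lambda>u x. marks (\<lambda>i. sat_pair t t' q i (fst u)) (x + snd u))
    (tl (args (Suc (length xs)))) ys \<longleftrightarrow> ys = xs"
proof -
  have *: "args (Suc (length xs)) = (old (arg_reg 0), 0) # tl (args (Suc (length xs)))"
    by (simp add: args_def upt_rec)
  have "stores t (arg_reg 0) x"
    using assms by (auto simp: judges_def)
  then show ?thesis
    using judges_args[OF assms, of t' q "x # ys"] by (subst (asm) length_Cons, subst (asm) *) simp
qed

section \<open>Soundness of the encoding\<close>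

definition single :: "nat \<Rightarrow> pvar set word" where
  "single d = (\<lambda>i. if i = d then {0} else {})"

lemma stores_single [simp]: "stores (single d) 0 n \<longleftrightarrow> n = d"
  by (auto simp: stores_alt single_def)

text \<open>Structural induction on \<open>g\<close>: all premises concern immediate subterms except
  the recursive one of \<open>PrimRec\<close>, where the recursion argument drops. So circular
  demands cannot support a false judgment. \<open>S\<close> stays fixed while the subterms
  shrink.\<close>

lemma judgment_sound:
  assumes step: "\<And>t d g k. t \<in> T \<Longrightarrow> d > 0 \<Longrightarrow> (g, k) \<in> S \<Longrightarrow> stores t label_reg (lab g k) \<Longrightarrow>
    \<exists>t'\<in>T. sat_pair t t' (single d) 0 (rule_body g k)"
  shows "t \<in> T \<Longrightarrow> set (subterms g (length xs)) \<subseteq> S \<Longrightarrow> judges t g xs \<Longrightarrow>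
    stores t result_reg y \<Longrightarrow> computes g xs y"
proof (induction g arbitrary: t xs y)
  case Zero
  \<comment> \<open>Rules without premises do not look at the demand, so any positive one will
    do.\<close>
  then obtain t' where "sat_pair t t' (single 1) 0 (rule_body Zero (length xs))"
    using step[of t 1 Zero "length xs"] by (auto simp: judges_def)
  then show ?case
    by (auto simp: stores_iff[OF Zero(4)] intro: computes.zero)
next
  case Succ
  then obtain t' where "sat_pair t t' (single 1) 0 (rule_body Succ (length xs))"
    using step[of t 1 Succ "length xs"] by (auto simp: judges_def)
  then obtain x where "xs = [x]" "y = Suc x"
    by (auto simp: stores_iff[OF Succ(4)] judges_arg[OF Succ(3)] length_Suc_conv split: if_splits)
  then show ?case
    by (auto intro: computes.succ)
next
  case (Proj i)
  then obtain t' where "sat_pair t t' (single 1) 0 (rule_body (Proj i) (length xs))"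
    using step[of t 1 "Proj i" "length xs"] by (auto simp: judges_def)
  then have "i < length xs" "y = xs ! i"
    by (auto simp: stores_iff[OF Proj(4)] judges_arg[OF Proj(3)] split: if_splits)
  then show ?case
    by (auto intro: computes.proj)
next
  case (Comp f gs)
  let ?k = "length xs"
  have rule: "\<exists>t'\<in>T. sat_pair t t' (single d) 0 (rule_body (Comp f gs) ?k)" if "d > 0" for d
    using that Comp.prems step[of t d "Comp f gs" ?k] by (auto simp: judges_def)
  \<comment> \<open>Different demands may be answered by unrelated traces. The auxiliary registers
    of the common trace \<open>t\<close> tie their results together.\<close>
  have "\<exists>y. stores t (aux_reg i) y \<and> computes (gs ! i) xs y" if i: "i < length gs" for i
  proof -
    obtain t' where t': "t' \<in> T" "sat_pair t t' (single (Suc i)) 0 (rule_body (Comp f gs) ?k)"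
      using rule by blast
    then have "sat_pair t t' (single (Suc i)) 0 (conj_body (premise (gs ! i) (args ?k))
        (plus_body (new result_reg) 0 (old (aux_reg i))))"
      using i by simp
    then obtain y where "judges t' (gs ! i) xs" "stores t' result_reg y" "stores t (aux_reg i) y"
      by (auto simp: sat_premise judges_args[OF Comp.prems(3)])
    moreover have "set (subterms (gs ! i) ?k) \<subseteq> S"
      using Comp.prems(2) i by (simp add: UN_subset_iff)
    ultimately show ?thesis
      using Comp.IH(2)[OF nth_mem[OF i] t'(1)] by blast
  qed
  then obtain z where z: "\<And>i. i < length gs \<Longrightarrow> stores t (aux_reg i) (z i)"
      "\<And>i. i < length gs \<Longrightarrow> computes (gs ! i) xs (z i)"
    by metis
  let ?ys = "map z [0..<length gs]"
  obtain t' where t': "t' \<in> T"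
      "sat_pair t t' (single (Suc (length gs))) 0 (rule_body (Comp f gs) ?k)"
    using rule by blast
  then have "sat_pair t t' (single (Suc (length gs))) 0 (conj_body (premise f (auxs (length gs)))
      (plus_body (new result_reg) 0 (old result_reg)))"
    by simp
  then obtain ys y' where ys: "judges t' f ys" "stores t' result_reg y'" "stores t result_reg y'"
      "list_all2 (\<lambda>u x. marks (\<lambda>i. sat_pair t t' (single (Suc (length gs))) i (fst u)) (x + snd u))
        (auxs (length gs)) ys"
    by (auto simp: sat_premise)
  have "ys = ?ys"
    using ys(4)
    by (auto simp: auxs_def list_all2_conv_all_nth stores_iff[OF z(1)] intro!: nth_equalityI)
  moreover have "y' = y"
    using ys(3) Comp.prems(4) by (rule stores_unique)
  moreover have "set (subterms f (length ?ys)) \<subseteq> S"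
    using Comp.prems(2) by simp
  ultimately have "computes f ?ys y"
    using Comp.IH(1)[OF t'(1)] ys(1,2) by simp
  moreover have "list_all2 (\<lambda>g y. computes g xs y) gs ?ys"
    using z(2) by (simp add: list_all2_conv_all_nth)
  ultimately show ?case
    by (auto intro: computes.comp)
next
  case (PrimRec f h)
  have rule: "\<exists>t'\<in>T. sat_pair t t' (single d) 0 (rule_body (PrimRec f h) (length xs))"
    if "d > 0" "t \<in> T" "judges t (PrimRec f h) xs" "(PrimRec f h, length xs) \<in> S" for d t xs
    using that step[of t d "PrimRec f h" "length xs"] by (auto simp: judges_def)
  \<comment> \<open>The recursive premise has the same function, so an inner induction on the first
    argument is needed; \<open>t\<close> varies because each step moves to another trace.\<close>
  have main: "computes (PrimRec f h) (n # xs) y"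
    if "t \<in> T" "set (subterms (PrimRec f h) (Suc (length xs))) \<subseteq> S"
      "judges t (PrimRec f h) (n # xs)" "stores t result_reg y" for n xs t y
    using that
  proof (induction n arbitrary: t y)
    case 0
    have z: "stores t (arg_reg 0) m \<longleftrightarrow> m = 0" for m
      using judges_arg[OF 0(3), of 0] by simp
    obtain t' where t': "t' \<in> T"
        "sat_pair t t' (single 1) 0 (rule_body (PrimRec f h) (length (0 # xs)))"
      using rule[of 1 t "0 # xs"] 0 by auto
    then have "judges t' f xs \<and> stores t' result_reg y"
      by (auto simp: sat_premise judges_tl_args[OF 0(3)] z stores_iff[OF 0(4)])
    then have "computes f xs y"
      using PrimRec.IH(1)[of t' xs y] t'(1) 0 by auto
    then show ?case
      by (rule computes.primrec_0)
  next
    case (Suc n)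
    have z: "stores t (arg_reg 0) m \<longleftrightarrow> m = Suc n" for m
      using judges_arg[OF Suc.prems(3), of 0] by simp
    \<comment> \<open>Demand 1 yields the previous value, kept in \<open>aux_reg 0\<close>; demand 2
      then yields the application of \<open>h\<close> to it.\<close>
    obtain t' where t': "t' \<in> T"
        "sat_pair t t' (single 1) 0 (rule_body (PrimRec f h) (length (Suc n # xs)))"
      using rule[of 1 t "Suc n # xs"] Suc.prems by auto
    then obtain y' where y': "judges t' (PrimRec f h) (n # xs)" "stores t' result_reg y'"
        "stores t (aux_reg 0) y'"
      by (auto simp: sat_premise judges_tl_args[OF Suc.prems(3)] list_all2_Cons1 z)
    have c: "computes (PrimRec f h) (n # xs) y'"
      using Suc.IH[of t' y'] t'(1) Suc.prems y' by auto
    obtain t'' where t'': "t'' \<in> T"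
        "sat_pair t t'' (single 2) 0 (rule_body (PrimRec f h) (length (Suc n # xs)))"
      using rule[of 2 t "Suc n # xs"] Suc.prems by auto
    then have "judges t'' h (n # y' # xs) \<and> stores t'' result_reg y"
      by (auto simp: sat_premise judges_tl_args[OF Suc.prems(3)] list_all2_Cons1 z
          stores_iff[OF y'(3)] stores_iff[OF Suc.prems(4)])
    then have "computes h (n # y' # xs) y"
      using PrimRec.IH(2)[of t'' "n # y' # xs" y] t''(1) Suc.prems by auto
    with c show ?case
      by (rule computes.primrec_Suc)
  qed
  \<comment> \<open>The rule for a primitive recursion without arguments is unsatisfiable, whatever
    the demand.\<close>
  have "xs \<noteq> []"
    using rule[of 1 t xs] PrimRec.prems by auto
  then show ?case
    using main PrimRec.prems by (cases xs) auto
next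
  case (Mu f)
  let ?k = "length xs"
  have rule: "\<exists>t'\<in>T. sat_pair t t' (single d) 0 (rule_body (Mu f) ?k)" if "d > 0" for d
    using that Mu.prems step[of t d "Mu f" ?k] by (auto simp: judges_def)
  have sub: "set (subterms f (length (m # xs))) \<subseteq> S" for m
    using Mu.prems(2) by auto
  have "\<exists>z>0. computes f (m # xs) z" if m: "m < y" for m
  proof -
    \<comment> \<open>Candidates are shifted by one because position 0 asks for the root:
      \<open>Suc m\<close> tests candidate \<open>m\<close>. Demands up to \<open>y\<close> require
      a positive result, and \<open>Suc y\<close> requires zero.\<close>
    obtain t' where t': "t' \<in> T" "sat_pair t t' (single (Suc m)) 0 (rule_body (Mu f) ?k)"
      using rule by blast
    have "Suc m \<le> y"
      using m by simp
    then obtain z where "judges t' f (m # xs)" "stores t' result_reg (Suc z)"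
      using t'(2)
      by (auto simp: sat_premise judges_args[OF Mu.prems(3)] list_all2_Cons1
          stores_iff[OF Mu.prems(4)])
    then show ?thesis
      using Mu.IH[OF t'(1) sub] by blast
  qed
  then have "\<forall>m<y. \<exists>z>0. computes f (m # xs) z"
    by blast
  moreover have "computes f (y # xs) 0"
  proof -
    obtain t' where t': "t' \<in> T" "sat_pair t t' (single (Suc y)) 0 (rule_body (Mu f) ?k)"
      using rule by blast
    then have "judges t' f (y # xs)" "stores t' result_reg 0"
      by (auto simp: sat_premise judges_args[OF Mu.prems(3)] list_all2_Cons1
          stores_iff[OF Mu.prems(4)])
    then show ?thesis
      using Mu.IH[OF t'(1) sub] by blast
  qed
  ultimately show ?case
    by (intro computes.mu)
qed

lemma satisfiable_imp_computes:
  assumes "satisfiable (diagonal_formula e (Neg (evaluation_body H)))"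
  shows "computes H [e] 0"
proof -
  obtain T t0 where T: "t0 \<in> T" "\<And>t q. t \<in> T \<Longrightarrow> q \<in> prop_traces 0 \<Longrightarrow>
      \<exists>t'\<in>T. input_reg \<in> t e \<and> sat_pair t t' q 0 (evaluation_body H)"
    using assms unfolding satisfiable_def models_diagonal_formula by blast
  have single: "single d \<in> prop_traces 0" for d
    by (auto simp: single_def prop_traces_def)
  \<comment> \<open>Demand 0, issued from any trace of the nonempty set, produces the root
    judgment.\<close>
  obtain t where t: "t \<in> T" "sat_pair t0 t (single 0) 0 (evaluation_body H)" "input_reg \<in> t0 e"
    using T single by blast
  have "sat_pair t0 t (single 0) 0 (premise H [(old input_reg, 0)])" "stores t result_reg 0"
    using t(2) by (simp_all add: evaluation_body_def single_def)
  then obtain x where x: "judges t H [x]" "stores t0 input_reg x"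
    by (auto simp: sat_premise list_all2_Cons1)
  \<comment> \<open>The root premise makes the occurrence of \<open>input_reg\<close> on
    \<open>t0\<close> unique, and the formula places one at \<open>e\<close>.\<close>
  have "x = e"
    using x(2) t(3) by (simp add: stores_alt)
  with x(1) \<open>stores t result_reg 0\<close> show ?thesis
  proof (intro judgment_sound[of T "set (subterms H 1)" t H "[e]"])
    fix t d and g :: recf and k
    assume *: "t \<in> T" "(d :: nat) > 0" "(g, k) \<in> set (subterms H 1)" "stores t label_reg (lab g k)"
    then obtain t' where "t' \<in> T" "sat_pair t t' (single d) 0 (evaluation_body H)"
      using T(2) single by blast
    then have "sat_pair t t' (single d) 0 (rule_body g k)"
      using * by (simp add: evaluation_body_def) (auto simp: single_def)
    with \<open>t' \<in> T\<close> show "\<exists>t'\<in>T. sat_pair t t' (single d) 0 (rule_body g k)"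
      by blast
  qed (use t(1) in auto)
qed

section \<open>Completeness of the encoding\<close>

text \<open>The function \<open>z\<close> provides the intermediate results that the last rule needs.\<close>

definition derivable :: "recf \<Rightarrow> nat list \<Rightarrow> nat \<Rightarrow> (nat \<Rightarrow> nat) \<Rightarrow> bool" where
  "derivable g xs y z \<longleftrightarrow> computes g xs y \<and>
     (\<forall>f gs. g = Comp f gs \<longrightarrow>
        (\<forall>i<length gs. computes (gs ! i) xs (z i)) \<and> computes f (map z [0..<length gs]) y) \<and>
     (\<forall>f h n xs'. g = PrimRec f h \<and> xs = Suc n # xs' \<longrightarrow>
        computes (PrimRec f h) (n # xs') (z 0) \<and> computes h (n # z 0 # xs') y)"

text \<open>Inversion of the last rule gives \<open>z\<close>: the inner results for a composition,
  the previous value for a recursion step, and anything otherwise.\<close>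

lemma computes_imp_derivable:
  assumes "computes g xs y"
  shows "\<exists>z. derivable g xs y z"
  using assms
proof (cases rule: computes.cases)
  case (comp gs ys f)
  have "map ((!) ys) [0..<length gs] = ys"
    using list_all2_lengthD[OF comp(2)] by (simp add: map_nth)
  with comp assms show ?thesis
    by (intro exI[of _ "(!) ys"]) (auto simp: derivable_def list_all2_conv_all_nth)
next
  case (primrec_Suc f h n xs' y')
  with assms show ?thesis
    by (intro exI[of _ "\<lambda>_. y'"]) (auto simp: derivable_def)
qed (use assms in \<open>auto simp: derivable_def\<close>)

definition trace_of :: "(ap \<Rightarrow> nat) \<Rightarrow> trace" where
  "trace_of \<rho> = (\<lambda>i. {r. \<rho> r = i})"

lemma stores_trace_of [simp]: "stores (trace_of \<rho>) r n \<longleftrightarrow> n = \<rho> r"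
  by (auto simp: stores_alt trace_of_def)

text \<open>The canonical model: it holds the correct judgments of all functions, not only of
  subterms of \<open>H\<close>, so every premise of a derivation is available.\<close>

definition judgment_traces :: "nat \<Rightarrow> trace set" where
  "judgment_traces e = {trace_of \<rho> | \<rho>. \<rho> input_reg = e \<and>
     (\<forall>g k. \<rho> label_reg = lab g k \<longrightarrow>
        derivable g (map (\<lambda>j. \<rho> (arg_reg j)) [0..<k]) (\<rho> result_reg) (\<lambda>j. \<rho> (aux_reg j)))}"

lemma judgment_traces_input: "t \<in> judgment_traces e \<Longrightarrow> stores t input_reg e"
  by (auto simp: judgment_traces_def)

lemma judgment_traces_label:
  assumes "t \<in> judgment_traces e" "stores t label_reg (lab g k)"
  obtains xs y z where "length xs = k" "judges t g xs" "stores t result_reg y"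
    "\<And>j. stores t (aux_reg j) (z j)" "derivable g xs y z"
proof -
  obtain \<rho> where \<rho>: "t = trace_of \<rho>"
      "\<And>g k. \<rho> label_reg = lab g k \<Longrightarrow>
        derivable g (map (\<lambda>j. \<rho> (arg_reg j)) [0..<k]) (\<rho> result_reg) (\<lambda>j. \<rho> (aux_reg j))"
    using assms(1) unfolding judgment_traces_def by blast
  then show thesis
    using assms(2)
    by (intro that[of "map (\<lambda>j. \<rho> (arg_reg j)) [0..<k]"]) (auto simp: judges_def)
qed

lemma judgment_trace_exists:
  assumes "computes g xs y"
  obtains t where "t \<in> judgment_traces e" "judges t g xs" "stores t result_reg y"
proof -
  obtain z where z: "derivable g xs y z"
    using computes_imp_derivable[OF assms] by blast
  \<comment> \<open>This inverts the numbering of \<open>arg_reg\<close> and \<open>aux_reg\<close>.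
    Argument registers beyond the length of \<open>xs\<close> get unspecified values, which no
    judgment reads.\<close>
  define \<rho> where "\<rho> r = (if r = 0 then lab g (length xs) else if r = 1 then y
    else if r = 2 then e else if odd r then xs ! ((r - 3) div 2) else z ((r - 4) div 2))" for r
  have \<rho>: "\<rho> label_reg = lab g (length xs)" "\<rho> result_reg = y" "\<rho> input_reg = e"
      "\<And>j. \<rho> (arg_reg j) = xs ! j" "\<And>j. \<rho> (aux_reg j) = z j"
    by (auto simp: \<rho>_def arg_reg_def aux_reg_def)
  have "map (\<lambda>j. \<rho> (arg_reg j)) [0..<length xs] = xs"
    by (simp add: \<rho> map_nth)
  with z have "trace_of \<rho> \<in> judgment_traces e"
    unfolding judgment_traces_def by (auto simp: \<rho> intro!: exI[of _ \<rho>])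
  moreover have "judges (trace_of \<rho>) g xs" "stores (trace_of \<rho>) result_reg y"
    by (auto simp: judges_def \<rho>)
  ultimately show thesis
    by (rule that)
qed

text \<open>A demand that selects a premise is answered by the trace of that premise, taken from a
  derivation. Any other demand triggers no implication, and \<open>t\<close> itself serves.\<close>

lemma rule_body_complete:
  assumes t: "t \<in> judgment_traces e" "stores t label_reg (lab g k)"
    and q: "stores q 0 d" "d > 0"
  shows "\<exists>t'\<in>judgment_traces e. sat_pair t t' q 0 (rule_body g k)"
proof -
  obtain xs y z where xs: "length xs = k" "judges t g xs" "stores t result_reg y"
      "\<And>j. stores t (aux_reg j) (z j)" "derivable g xs y z"
    using judgment_traces_label[OF t] by blast
  note stores = stores_iff[OF q(1)] stores_iff[OF xs(3)] stores_iff[OF xs(4)] judges_arg[OF xs(2)]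
  have args: "list_all2 (\<lambda>u x. marks (\<lambda>i. sat_pair t t' q i (fst u)) (x + snd u)) (args k) ys
      \<longleftrightarrow> ys = xs" for t' ys
    using judges_args[OF xs(2)] xs(1) by simp
  have witness: thesis
    if "computes f us v" "\<And>t'. t' \<in> judgment_traces e \<Longrightarrow> judges t' f us \<Longrightarrow>
      stores t' result_reg v \<Longrightarrow> thesis" for f us v thesis
    using judgment_trace_exists[OF that(1)] that(2) by blast
  have comp: "computes g xs y"
    using xs(5) by (simp add: derivable_def)
  show ?thesis
  proof (cases g)
    case Zero
    then have "y = 0"
      using comp by (auto elim: computes.cases)
    then show ?thesis
      using t(1) Zero by (auto simp: stores)
  next
    case Succ
    then have "k = 1" "y = Suc (xs ! 0)"
      using comp xs(1) by (auto elim: computes.cases)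
    then show ?thesis
      using t(1) Succ xs(1) by (auto simp: stores)
  next
    case (Proj i)
    then have "i < k" "y = xs ! i"
      using comp xs(1) by (auto elim: computes.cases)
    then show ?thesis
      using t(1) Proj xs(1) by (auto simp: stores)
  next
    case (Comp f gs)
    have gs: "computes (gs ! i) xs (z i)" if "i < length gs" for i
      using xs(5) that Comp by (simp add: derivable_def)
    have f: "computes f (map z [0..<length gs]) y"
      using xs(5) Comp by (simp add: derivable_def)
    consider i where "d = Suc i" "i < length gs" | "d = Suc (length gs)" | "d > Suc (length gs)"
      using q(2) by (cases d) (auto, metis linorder_neqE_nat)
    then show ?thesis
    proof cases
      case (1 i)
      obtain t' where t': "t' \<in> judgment_traces e" "judges t' (gs ! i) xs"
          "stores t' result_reg (z i)"
        using witness[OF gs[OF 1(2)]] by blast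
      have "sat_pair t t' q 0 (rule_body g k)"
        using 1 t'(2,3) by (simp add: Comp stores stores_iff[OF t'(3)] sat_premise args)
      with t'(1) show ?thesis by blast
    next
      case 2
      obtain t' where t': "t' \<in> judgment_traces e" "judges t' f (map z [0..<length gs])"
          "stores t' result_reg y"
        using witness[OF f] by blast
      have "sat_pair t t' q 0 (premise f (auxs (length gs)))"
        using t'(2) xs(4) by (auto simp: sat_premise auxs_def list_all2_conv_all_nth
            intro!: exI[of _ "map z [0..<length gs]"])
      then have "sat_pair t t' q 0 (rule_body g k)"
        using 2 by (simp add: Comp stores stores_iff[OF t'(3)])
      with t'(1) show ?thesis by blast
    next
      case 3
      then have "sat_pair t t q 0 (rule_body g k)"
        by (simp add: Comp stores)
      with t(1) show ?thesis by blast
    qed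
  next
    case (PrimRec f h)
    obtain n xs' where n: "xs = n # xs'"
      using comp PrimRec by (auto elim: computes.cases)
    then have k: "k = Suc (length xs')"
      using xs(1) by simp
    have arg0: "stores t (arg_reg 0) m \<longleftrightarrow> m = n" for m
      using judges_arg[OF xs(2), of 0] n by simp
    note tl_args = judges_tl_args[OF xs(2)[unfolded n]]
    consider "n = 0" | m where "n = Suc m" "d = 1" | m where "n = Suc m" "d = 2"
      | m where "n = Suc m" "d > 2"
      using q(2) by (cases n) (auto, linarith)
    then show ?thesis
    proof cases
      case 1
      then have "computes f xs' y"
        using comp n PrimRec by (auto elim: computes.cases)
      then obtain t' where t': "t' \<in> judgment_traces e" "judges t' f xs'" "stores t' result_reg y"
        using witness by blast
      have "sat_pair t t' q 0 (rule_body g k)"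
        using 1 t'(2)
        by (simp add: PrimRec k arg0 stores stores_iff[OF t'(3)] sat_premise tl_args)
      with t'(1) show ?thesis by blast
    next
      case (2 m)
      then have "computes (PrimRec f h) (m # xs') (z 0)"
        using xs(5) n PrimRec by (simp add: derivable_def)
      then obtain t' where t': "t' \<in> judgment_traces e" "judges t' (PrimRec f h) (m # xs')"
          "stores t' result_reg (z 0)"
        using witness by blast
      have "sat_pair t t' q 0 (rule_body g k)"
        using 2 t'(2)
        by (simp add: PrimRec k arg0 stores stores_iff[OF t'(3)] sat_premise tl_args
            list_all2_Cons1)
      with t'(1) show ?thesis by blast
    next
      case (3 m)
      then have "computes h (m # z 0 # xs') y"
        using xs(5) n PrimRec by (simp add: derivable_def)
      then obtain t' where t': "t' \<in> judgment_traces e" "judges t' h (m # z 0 # xs')"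
          "stores t' result_reg y"
        using witness by blast
      have "sat_pair t t' q 0 (rule_body g k)"
        using 3 t'(2)
        by (simp add: PrimRec k arg0 stores stores_iff[OF t'(3)] sat_premise tl_args
            list_all2_Cons1)
      with t'(1) show ?thesis by blast
    next
      case 4
      then have "sat_pair t t q 0 (rule_body g k)"
        by (simp add: PrimRec k arg0 stores)
      with t(1) show ?thesis by blast
    qed
  next
    case (Mu f)
    then have f: "computes f (y # xs) 0" "\<forall>m<y. \<exists>v>0. computes f (m # xs) v"
      using comp by (auto elim: computes.cases)
    obtain m where m: "d = Suc m"
      using q(2) by (cases d) auto
    consider "m < y" | "m = y" | "m > y"
      by linarith
    then show ?thesis
    proof cases
      case 1
      then obtain v where "computes f (m # xs) (Suc v)"
        using f(2) by (metis gr0_conv_Suc)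
      then obtain t' where t': "t' \<in> judgment_traces e" "judges t' f (m # xs)"
          "stores t' result_reg (Suc v)"
        using witness by blast
      have "sat_pair t t' q 0 (rule_body g k)"
        using 1 t'(2)
        by (simp add: Mu m stores stores_iff[OF t'(3)] sat_premise args list_all2_Cons1)
      with t'(1) show ?thesis by blast
    next
      case 2
      obtain t' where t': "t' \<in> judgment_traces e" "judges t' f (y # xs)"
          "stores t' result_reg 0"
        using witness[OF f(1)] by blast
      have "sat_pair t t' q 0 (rule_body g k)"
        using 2 t'(2)
        by (simp add: Mu m stores stores_iff[OF t'(3)] sat_premise args list_all2_Cons1)
      with t'(1) show ?thesis by blast
    next
      case 3
      then have "sat_pair t t q 0 (rule_body g k)"
        by (simp add: Mu m stores)
      with t(1) show ?thesis by blast
    qed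
  qed
qed

lemma computes_imp_satisfiable:
  assumes "computes H [e] 0"
  shows "satisfiable (diagonal_formula e (Neg (evaluation_body H)))"
proof -
  obtain t0 where t0: "t0 \<in> judgment_traces e" "judges t0 H [e]" "stores t0 result_reg 0"
    using judgment_trace_exists[OF assms] by blast
  have "\<exists>t'\<in>judgment_traces e. sat_pair t t' q 0 (evaluation_body H)"
    if t: "t \<in> judgment_traces e" for t q
  proof (cases "0 \<in> q 0")
    case True
    then have "sat_pair t t0 q 0 (evaluation_body H)"
      using t0(2,3) judgment_traces_input[OF t]
      by (auto simp: evaluation_body_def sat_premise list_all2_Cons1)
    with t0(1) show ?thesis by blast
  next
    case no_root: False
    show ?thesis
    proof (cases "\<exists>d g k. stores q 0 d \<and> stores t label_reg (lab g k)")
      case True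
      then obtain d g k where d: "stores q 0 d" "stores t label_reg (lab g k)"
        by blast
      then have "d > 0"
        using no_root by (auto simp: stores_alt intro: Nat.gr0I)
      then obtain t' where t': "t' \<in> judgment_traces e" "sat_pair t t' q 0 (rule_body g k)"
        using rule_body_complete[OF t d(2,1)] by blast
      then have "sat_pair t t' q 0 (evaluation_body H)"
        using no_root by (auto simp: evaluation_body_def stores_iff[OF d(2)])
      with t'(1) show ?thesis by blast
    next
      case False
      \<comment> \<open>Without a unique demand or a meaningful label every guard fails, so any
        trace is a witness.\<close>
      then have "sat_pair t t q 0 (evaluation_body H)"
        using no_root by (auto simp: evaluation_body_def)
      with t show ?thesis by blast
    qed
  qed
  moreover have "input_reg \<in> t e" if "t \<in> judgment_traces e" for t
    using judgment_traces_input[OF that] by (simp add: stores_alt)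
  ultimately have "models (judgment_traces e) (diagonal_formula e (Neg (evaluation_body H)))"
    by (simp add: models_diagonal_formula)
  with t0(1) show ?thesis
    unfolding satisfiable_def by blast
qed

section \<open>The diagonal formula is computable\<close>

primrec const_rf :: "nat \<Rightarrow> recf" where
  "const_rf 0 = Zero"
| "const_rf (Suc n) = Comp Succ [const_rf n]"

definition add_rf :: recf where
  "add_rf = PrimRec (Proj 0) (Comp Succ [Proj 1])"

definition triangle_rf :: recf where
  "triangle_rf = PrimRec Zero (Comp Succ [Comp add_rf [Proj 0, Proj 1]])"

text \<open>Follows the Cantor pairing
  \<open>prod_encode (m, n) = triangle (m + n) + m\<close>.\<close>

definition pair_rf :: "recf \<Rightarrow> recf \<Rightarrow> recf" where
  "pair_rf f g = Comp add_rf [Comp triangle_rf [Comp add_rf [f, g]], f]"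

lemma computes_Comp1: "computes g xs y \<Longrightarrow> computes f [y] z \<Longrightarrow> computes (Comp f [g]) xs z"
  by (rule computes.comp[of _ _ "[y]"]) auto

lemma computes_Comp2:
  "computes g xs y \<Longrightarrow> computes h xs y' \<Longrightarrow> computes f [y, y'] z \<Longrightarrow> computes (Comp f [g, h]) xs z"
  by (rule computes.comp[of _ _ "[y, y']"]) auto

lemma computes_Proj: "i < length xs \<Longrightarrow> y = xs ! i \<Longrightarrow> computes (Proj i) xs y"
  by (simp add: computes.proj)

lemma computes_const_rf: "computes (const_rf n) xs n"
  by (induction n) (auto intro: computes.zero computes_Comp1 computes.succ)

lemma computes_add_rf: "computes add_rf [m, n] (m + n)"
  unfolding add_rf_def
proof (induction m)
  case 0
  show ?case by (rule computes.primrec_0) (simp add: computes_Proj)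
next
  case (Suc m)
  show ?case
    by (rule computes.primrec_Suc[OF Suc]) (auto intro!: computes_Comp1 computes_Proj computes.succ)
qed

lemma computes_triangle_rf: "computes triangle_rf [n] (triangle n)"
  unfolding triangle_rf_def
proof (induction n)
  case 0
  show ?case by (auto intro: computes.primrec_0 computes.zero)
next
  case (Suc n)
  have "computes (Comp Succ [Comp add_rf [Proj 0, Proj 1]]) [n, triangle n] (Suc (n + triangle n))"
    by (rule computes_Comp1[OF computes_Comp2[OF computes_Proj computes_Proj computes_add_rf]
          computes.succ]) simp_all
  then show ?case
    by (intro computes.primrec_Suc[OF Suc]) (simp add: add.commute)
qed

lemma computes_pair_rf:
  assumes "computes f xs m" "computes g xs n"
  shows "computes (pair_rf f g) xs (prod_encode (m, n))"
  unfolding pair_rf_def prod_encode_def prod.case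
  by (rule computes_Comp2[OF computes_Comp1[OF computes_Comp2[OF assms computes_add_rf]
        computes_triangle_rf] assms(1) computes_add_rf])

text \<open>The constant 4 is the tag of \<open>Next\<close> in \<open>body_code\<close>;
  \<open>Proj 1\<close> is the previous value in the recursion step.\<close>

definition numeral_rf :: recf where
  "numeral_rf = PrimRec (const_rf (body_code (Neg (old input_reg)))) (pair_rf (const_rf 4) (Proj 1))"

lemma computes_numeral_rf:
  "computes numeral_rf [n] (body_code ((Next ^^ n) (Neg (old input_reg))))"
  unfolding numeral_rf_def
proof (induction n)
  case 0
  show ?case
    unfolding funpow_0 by (intro computes.primrec_0 computes_const_rf)
next
  case (Suc n)
  show ?case
    by (rule computes.primrec_Suc[OF Suc])
      (auto simp del: body_code.simps(3) intro!: computes_pair_rf computes_const_rf computes_Proj)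
qed

text \<open>From the outside in, the constants are the tags and variables of
  \<open>AllTrace 0\<close>, \<open>AllProp 0\<close>, \<open>ExTrace 1\<close>, then the tags of
  \<open>Body\<close>, \<open>Neg\<close> and \<open>Disj\<close>. The one argument serves both as
  input \<open>e\<close> and as code of \<open>G\<close>.\<close>

definition diagonal_rf :: recf where
  "diagonal_rf = (let pair = (\<lambda>n. pair_rf (const_rf n)) in
     pair 0 (pair 0 (pair 3 (pair 0 (pair 1 (pair 1 (pair 4 (pair 2 (pair 3
       (pair_rf numeral_rf (Proj 0)))))))))))"

lemma computes_diagonal_rf:
  "computes diagonal_rf [body_code G] (formula_code (diagonal_formula (body_code G) G))"
proof -
  have "computes numeral_rf [n] m \<Longrightarrow> computes diagonal_rf [n]
     (prod_encode (0, prod_encode (0, prod_encode (3, prod_encode (0, prod_encode (1, prod_encode (1,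
       prod_encode (4, prod_encode (2, prod_encode (3, prod_encode (m, n)))))))))))" for m n
    unfolding diagonal_rf_def Let_def
    by (intro computes_pair_rf computes_const_rf computes_Proj) auto
  from this[OF computes_numeral_rf] show ?thesis
    by (simp add: diagonal_formula_def)
qed

section \<open>Closedness and membership in the fragment\<close>

lemma body_vars_derived [simp]:
  "body_tvars (conj_body \<psi> \<chi>) = body_tvars \<psi> \<union> body_tvars \<chi>"
  "body_pvars (conj_body \<psi> \<chi>) = body_pvars \<psi> \<union> body_pvars \<chi>"
  "body_tvars (imp_body \<psi> \<chi>) = body_tvars \<psi> \<union> body_tvars \<chi>"
  "body_pvars (imp_body \<psi> \<chi>) = body_pvars \<psi> \<union> body_pvars \<chi>"
  "body_tvars (all_body \<psi>s) = (\<Union>\<psi>\<in>set \<psi>s. body_tvars \<psi>)"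
  "body_pvars (all_body \<psi>s) = insert 0 (\<Union>\<psi>\<in>set \<psi>s. body_pvars \<psi>)"
  "body_tvars (ev_body \<psi>) = body_tvars \<psi>"
  "body_pvars (ev_body \<psi>) = insert 0 (body_pvars \<psi>)"
  "body_tvars ((Next ^^ n) \<psi>) = body_tvars \<psi>"
  "body_pvars ((Next ^^ n) \<psi>) = body_pvars \<psi>"
  "body_tvars (once_body \<psi>) = body_tvars \<psi>"
  "body_pvars (once_body \<psi>) = insert 0 (body_pvars \<psi>)"
  "body_tvars (is_body \<psi> n) = body_tvars \<psi>"
  "body_pvars (is_body \<psi> n) = insert 0 (body_pvars \<psi>)"
  "body_tvars (pos_body \<psi>) = body_tvars \<psi>"
  "body_pvars (pos_body \<psi>) = insert 0 (body_pvars \<psi>)"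
  "body_tvars (plus_body \<psi> n \<chi>) = body_tvars \<psi> \<union> body_tvars \<chi>"
  "body_pvars (plus_body \<psi> n \<chi>) = insert 0 (body_pvars \<psi> \<union> body_pvars \<chi>)"
  "body_tvars (le_body \<psi> \<chi>) = body_tvars \<psi> \<union> body_tvars \<chi>"
  "body_pvars (le_body \<psi> \<chi>) = insert 0 (body_pvars \<psi> \<union> body_pvars \<chi>)"
proof -
  show *:
    "body_tvars (conj_body \<psi> \<chi>) = body_tvars \<psi> \<union> body_tvars \<chi>"
    "body_pvars (conj_body \<psi> \<chi>) = body_pvars \<psi> \<union> body_pvars \<chi>"
    "body_tvars (ev_body \<psi>) = body_tvars \<psi>"
    "body_pvars (ev_body \<psi>) = insert 0 (body_pvars \<psi>)"
    for \<psi> \<chi>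
    by (auto simp: conj_body_def ev_body_def)
  show Next: "body_tvars ((Next ^^ n) \<psi>) = body_tvars \<psi>"
    "body_pvars ((Next ^^ n) \<psi>) = body_pvars \<psi>" for n \<psi>
    by (induction n) auto
  show once: "body_tvars (once_body \<psi>) = body_tvars \<psi>"
    "body_pvars (once_body \<psi>) = insert 0 (body_pvars \<psi>)" for \<psi>
    by (auto simp: once_body_def *)
  show "body_tvars (all_body \<psi>s) = (\<Union>\<psi>\<in>set \<psi>s. body_tvars \<psi>)"
    "body_pvars (all_body \<psi>s) = insert 0 (\<Union>\<psi>\<in>set \<psi>s. body_pvars \<psi>)"
    by (induction \<psi>s) (auto simp: all_body_def *)
  show "body_tvars (is_body \<psi> n) = body_tvars \<psi>"
    "body_pvars (is_body \<psi> n) = insert 0 (body_pvars \<psi>)"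
    "body_tvars (plus_body \<psi> n \<chi>) = body_tvars \<psi> \<union> body_tvars \<chi>"
    "body_pvars (plus_body \<psi> n \<chi>) = insert 0 (body_pvars \<psi> \<union> body_pvars \<chi>)"
    "body_tvars (le_body \<psi> \<chi>) = body_tvars \<psi> \<union> body_tvars \<chi>"
    "body_pvars (le_body \<psi> \<chi>) = insert 0 (body_pvars \<psi> \<union> body_pvars \<chi>)"
    "body_tvars (pos_body \<psi>) = body_tvars \<psi>"
    "body_pvars (pos_body \<psi>) = insert 0 (body_pvars \<psi>)"
    by (auto simp: is_body_def pos_body_def plus_body_def le_body_def * Next once)
qed (auto simp: imp_body_def)

lemma premise_vars:
  assumes "\<forall>u\<in>set us. body_tvars (fst u) \<subseteq> {0, Suc 0} \<and> body_pvars (fst u) \<subseteq> {0}"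
  shows "body_tvars (premise g us) \<subseteq> {0, Suc 0} \<and> body_pvars (premise g us) \<subseteq> {0}"
  using assms by (auto simp: premise_def all_set_conv_all_nth)

lemma rule_body_vars:
  "body_tvars (rule_body g k) \<subseteq> {0, Suc 0} \<and> body_pvars (rule_body g k) \<subseteq> {0}"
proof -
  have "\<forall>u\<in>set (args k). body_tvars (fst u) \<subseteq> {0, Suc 0} \<and> body_pvars (fst u) \<subseteq> {0}"
    "\<forall>u\<in>set (tl (args k)). body_tvars (fst u) \<subseteq> {0, Suc 0} \<and> body_pvars (fst u) \<subseteq> {0}"
    "\<forall>u\<in>set (auxs k). body_tvars (fst u) \<subseteq> {0, Suc 0} \<and> body_pvars (fst u) \<subseteq> {0}" for k
    by (auto simp: args_def auxs_def simp flip: map_tl)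
  then show ?thesis
    by (cases g) (simp_all add: premise_vars UN_subset_iff)
qed

lemma diagonal_formula_in_fragment:
  "diagonal_formula e (Neg (evaluation_body H)) \<in> forall_exists_fragment"
proof -
  have "body_tvars (evaluation_body H) \<subseteq> {0, Suc 0}" "body_pvars (evaluation_body H) \<subseteq> {0}"
    using premise_vars[of "[(old input_reg, 0)]" H] rule_body_vars
    by (simp_all add: evaluation_body_def UN_subset_iff split_beta)
  then show ?thesis
    by (auto simp: forall_exists_fragment_def closed_formula_def diagonal_formula_def)
qed

section \<open>Diagonalization against a decision procedure\<close>

theorem theorem7: "\<not> decidable_on formula_code forall_exists_fragment satisfiable"
proof
  assume "decidable_on formula_code forall_exists_fragment satisfiable"
  then obtain D where D: "\<And>\<phi>. \<phi> \<in> forall_exists_fragment \<Longrightarrow>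
      computes D [formula_code \<phi>] (if satisfiable \<phi> then 1 else 0)"
    unfolding decidable_on_def by blast
  \<comment> \<open>On the code of \<open>G\<close>, \<open>H\<close> returns the verdict of
    \<open>D\<close> on \<open>\<phi>\<close>, while \<open>G\<close> in turn describes the
    evaluation of \<open>H\<close>.\<close>
  define H where "H = Comp D [diagonal_rf]"
  define G where "G = Neg (evaluation_body H)"
  define \<phi> where "\<phi> = diagonal_formula (body_code G) G"
  have "computes H [body_code G] (if satisfiable \<phi> then 1 else 0)"
    unfolding H_def \<phi>_def G_def
    by (rule computes_Comp1[OF computes_diagonal_rf D[OF diagonal_formula_in_fragment]])
  \<comment> \<open>Satisfiability thus amounts to the verdict 0, which \<open>D\<close> gives
    exactly in the unsatisfiable case.\<close>
  moreover have "satisfiable \<phi> \<longleftrightarrow> computes H [body_code G] 0"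
    using satisfiable_imp_computes computes_imp_satisfiable unfolding \<phi>_def G_def by blast
  ultimately show False
    using computes_deterministic by (fastforce split: if_splits)
qed

end
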